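(* Let $D_1,\dots,D_m\subseteq\mathbb{R}^n$ be nonempty closed (possibly nonconvex) sets with $\bigcap_{i=1}^mD_i^\infty=\{0\}$, let $C=\mathbb{R}^n$, $\psi\in\Theta$, $\Psi(x):=\sum_{i=1}^m\psi(d_{D_i}^2(x))$, and suppose that the function $$\mathfrak{M}(x,\xi,u):=\sum_{i=1}^m\left[\rho^*(u_i)-u_i\|x-\xi_i\|^2+\delta_{D_i}(\xi_i)\right],\quad x\in\mathbb{R}^n,\ \xi=(\xi_1,\dots,\xi_m)\in\mathbb{R}^{mn},\ u\in\mathbb{R}^m,$$ is a KL function. Let $\{x^t\}$ be the sequence generated by the algorithm sGP$_{ls}$ with $M=0$ applied to $\min_{x\in C}\Psi(x)$. Then $\{x^t\}$ converges to a stationary point of $\Psi$.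
   Context: $\Theta$ denotes the set of level-bounded (i.e., $\{s\ge0:\psi(s)\le\gamma\}$ is bounded for every $\gamma\in\mathbb{R}$) continuous concave functions $\psi:\mathbb{R}_+\to\mathbb{R}_+$ such that: (1) $\psi$ is continuously differentiable on $(0,\infty)$ with positive derivative and $\psi(0)=0$; (2) $\lim_{s\downarrow0}\psi'(s)$ exists (as a real number) and is positive, and the right derivative $\psi'_+$ is Lipschitz continuous on $\mathbb{R}_+=[0,\infty)$. The convex function $\rho:\mathbb{R}\to\mathbb{R}$ is defined by $\rho(s)=-\psi(s)$ if $s\ge0$ and $\rho(s)=s^2-ls$ if $s<0$, where $l:=\psi_+'(0)>0$; $\rho^*$ is its convex conjugate. For a nonempty closed set $D\subseteq\mathbb{R}^n$: $d_D(x)=\inf_{y\in D}\|x-y\|$ (also written $\mathrm{dist}(x,D)$); $P_D(x)=\{y\in D:\|x-y\|=d_D(x)\}$ is the set of projections; $D^\infty:=\{x:\exists\, x^t\in D,\ \lambda_t\downarrow0\text{ with }\lambda_tx^t\to x\}$ is the horizon cone; $\delta_D$ is the indicator function ($0$ on $D$, $+\infty$ elsewhere). For a proper closed $f$ and $\bar x\in\mathrm{dom} f$, $\widehat\partial f(\bar x)=\{v:\liminf_{x\to\bar x,x\ne\bar x}\frac{f(x)-f(\bar x)-\langle v,x-\bar x\rangle}{\|x-\bar x\|}\ge0\}$ and $\partial f(\bar x)=\{v:\exists\,x^t\to\bar x,\ f(x^t)\to f(\bar x),\ v^t\in\widehat\partial f(x^t),\ v^t\to v\}$ (empty outside $\mathrm{dom}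 f$); $\mathrm{dom}\,\partial f=\{x:\partial f(x)\ne\emptyset\}$. Since $C=\mathbb{R}^n$, $\bar x$ is a stationary point of $\Psi$ if $0\in\sum_{i=1}^m2\psi_+'(d_{D_i}^2(\bar x))(\bar x-P_{D_i}(\bar x))$ (sum of sets). For $\nu\in(0,\infty]$, $\Xi_\nu$ is the set of continuous concave functions $\phi:[0,\nu)\to\mathbb{R}_+$ that are continuously differentiable on $(0,\nu)$ with positive derivatives and satisfy $\phi(0)=0$. A proper closed function $f$ satisfies the KL property at $\hat x\in\mathrm{dom}\,\partial f$ if there exist a neighborhood $\mathcal N$ of $\hat x$, $\nu\in(0,\infty]$ and $\phi\in\Xi_\nu$ such that $\phi'(f(x)-f(\hat x))\,\mathrm{dist}(0,\partial f(x))\ge1$ whenever $x\in\mathcal N$ and $f(\hat x)<f(x)<f(\hat x)+\nu$. $f$ is a KL function if it satisfies the KL property at every point of $\mathrm{dom}\,\partial f$. Algorithm sGP$_{ls}$: Choose $\alpha_{\max}>\alpha_{\min}>0$, $\eta\in(0,1)$, $\sigma>0$, an integer $M\ge0$ and $x^0\in C$. For $t=0,1,2,\dots$: choose any $\alpha_t^0\in[\alpha_{\min},\alpha_{\max}]$, set $\alpha=\alpha_t^0$, pick any $\xi_i^t\in P_{D_i}(x^t)$ for $i=1,\dots,m$, and set $g^t:=2\sum_{i=1}^m\psi_+'(d_{D_i}^2(x^t))(x^t-\xi_i^t)$. Inner loop: choose any $\tilde u\in\operatorname{arg\,min}_{u\in C}\{\langle g^t,u-x^t\rangle+\frac1{2\alpha}\|u-x^t\|^2\}$;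 if $\Psi(\tilde u)-\max_{\max\{t-M,0\}\le i\le t}\Psi(x^i)\le-\frac\sigma2\|\tilde u-x^t\|^2$, set $\alpha_t:=\alpha$, $x^{t+1}:=\tilde u$ and pass to the next $t$; otherwise replace $\alpha$ by $\eta\alpha$ and repeat the inner loop. *)

theory Defs
  imports "HOL-Analysis.Analysis"
begin

section \<open>The function class \<open>\<Theta>\<close> and the conjugate of \<open>\<rho>\<close>\<close>

definition C1_pos_deriv_on :: "(real \<Rightarrow> real) \<Rightarrow> real set \<Rightarrow> bool" where
  "C1_pos_deriv_on f S \<longleftrightarrow>
     (\<forall>s\<in>S. f differentiable (at s) \<and> deriv f s > 0) \<and> continuous_on S (deriv f)"

definition right_deriv :: "(real \<Rightarrow> real) \<Rightarrow> real \<Rightarrow> real" where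
  "right_deriv f s = (THE d. (f has_real_derivative d) (at_right s))"

text \<open>Functions on \<open>[0, \<infinity>)\<close> are total functions of which only the values on \<^term>\<open>{0::real..}\<close> matter.\<close>

definition Theta :: "(real \<Rightarrow> real) set" where
  "Theta = {\<psi>.
     (\<forall>s\<ge>0. \<psi> s \<ge> 0) \<and> continuous_on {0..} \<psi> \<and> concave_on {0..} \<psi> \<and>
     (\<forall>\<gamma>. bounded {s. s \<ge> 0 \<and> \<psi> s \<le> \<gamma>}) \<and>
     C1_pos_deriv_on \<psi> {0<..} \<and> \<psi> 0 = 0 \<and>
     (\<exists>c>0. (deriv \<psi> \<longlongrightarrow> c) (at_right 0)) \<and>
     (\<exists>L. L-lipschitz_on {0..} (right_deriv \<psi>))}"

definition rho :: "(real \<Rightarrow> real) \<Rightarrow> real \<Rightarrow> real" where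
  "rho \<psi> s = (if s \<ge> 0 then - \<psi> s else s\<^sup>2 - right_deriv \<psi> 0 * s)"

definition convex_conjugate :: "('a::real_inner \<Rightarrow> ereal) \<Rightarrow> 'a \<Rightarrow> ereal" where
  "convex_conjugate f u = (SUP s. ereal (inner u s) - f s)"

definition indicator_fun :: "'a set \<Rightarrow> 'a \<Rightarrow> ereal" where
  "indicator_fun D x = (if x \<in> D then 0 else \<infinity>)"


section \<open>Projections and horizon cones\<close>

definition proj_set :: "'a::metric_space set \<Rightarrow> 'a \<Rightarrow> 'a set" where
  "proj_set D x = {y \<in> D. dist x y = infdist x D}"

definition horizon_cone :: "'a::real_normed_vector set \<Rightarrow> 'a set" where
  "horizon_cone D = {x. \<exists>y c. (\<forall>t::nat. y t \<in> D) \<and> (\<forall>t. c t > (0::real)) \<and>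
     c \<longlonglongrightarrow> 0 \<and> (\<lambda>t. c t *\<^sub>R y t) \<longlonglongrightarrow> x}"


section \<open>Subdifferentials and the Kurdyka--Lojasiewicz property\<close>

definition edomain :: "('a \<Rightarrow> ereal) \<Rightarrow> 'a set" where
  "edomain f = {x. f x < \<infinity>}"

definition proper_closed :: "('a::real_inner \<Rightarrow> ereal) \<Rightarrow> bool" where
  "proper_closed f \<longleftrightarrow> (\<forall>x. f x \<noteq> -\<infinity>) \<and> edomain f \<noteq> {} \<and>
     closed {(x, r::real). f x \<le> ereal r}"

definition regular_subdiff :: "('a::real_inner \<Rightarrow> ereal) \<Rightarrow> 'a \<Rightarrow> 'a set" where
  "regular_subdiff f z = (if z \<in> edomain f then
     {v. Liminf (at z) (\<lambda>x. (f x - f z - ereal (inner v (x - z))) / ereal (norm (x - z))) \<ge> 0}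
     else {})"

definition limiting_subdiff :: "('a::real_inner \<Rightarrow> ereal) \<Rightarrow> 'a \<Rightarrow> 'a set" where
  "limiting_subdiff f z = (if z \<in> edomain f then
     {v. \<exists>x w. x \<longlonglongrightarrow> z \<and> (\<lambda>t. f (x t)) \<longlonglongrightarrow> f z \<and>
           (\<forall>t::nat. w t \<in> regular_subdiff f (x t)) \<and> w \<longlonglongrightarrow> v}
     else {})"

text \<open>Unlike \<^const>\<open>infdist\<close>, this distance to the empty set is \<open>\<infinity>\<close>, so that the KL inequality
  holds at points with empty subdifferential.\<close>

definition edist_set :: "'a::metric_space \<Rightarrow> 'a set \<Rightarrow> ereal" where
  "edist_set x A = (INF y\<in>A. ereal (dist x y))"

definition Xi :: "ereal \<Rightarrow> (real \<Rightarrow> real) set" where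
  "Xi \<nu> = {\<phi>.
     (\<forall>s. 0 \<le> s \<and> ereal s < \<nu> \<longrightarrow> \<phi> s \<ge> 0) \<and>
     continuous_on {s. 0 \<le> s \<and> ereal s < \<nu>} \<phi> \<and> concave_on {s. 0 \<le> s \<and> ereal s < \<nu>} \<phi> \<and>
     C1_pos_deriv_on \<phi> {s. 0 < s \<and> ereal s < \<nu>} \<and> \<phi> 0 = 0}"

definition KL_at :: "('a::real_inner \<Rightarrow> ereal) \<Rightarrow> 'a \<Rightarrow> bool" where
  "KL_at f z \<longleftrightarrow> (\<exists>N \<nu> \<phi>. open N \<and> z \<in> N \<and> 0 < \<nu> \<and> \<phi> \<in> Xi \<nu> \<and>
     (\<forall>x\<in>N. f z < f x \<and> f x < f z + \<nu> \<longrightarrow>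
        ereal (deriv \<phi> (real_of_ereal (f x - f z))) * edist_set 0 (limiting_subdiff f x) \<ge> 1))"

definition KL_function :: "('a::real_inner \<Rightarrow> ereal) \<Rightarrow> bool" where
  "KL_function f \<longleftrightarrow> proper_closed f \<and> (\<forall>z. limiting_subdiff f z \<noteq> {} \<longrightarrow> KL_at f z)"


section \<open>The optimization problem\<close>

definition Psi :: "(real \<Rightarrow> real) \<Rightarrow> ('m::finite \<Rightarrow> 'a::euclidean_space set) \<Rightarrow> 'a \<Rightarrow> real" where
  "Psi \<psi> D x = (\<Sum>i\<in>UNIV. \<psi> ((infdist x (D i))\<^sup>2))"

definition frakM :: "(real \<Rightarrow> real) \<Rightarrow> ('m::finite \<Rightarrow> 'a::euclidean_space set) \<Rightarrow>
    'a \<times> ('a ^ 'm) \<times> (real ^ 'm) \<Rightarrow> ereal" where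
  "frakM \<psi> D = (\<lambda>(x, \<xi>, u). \<Sum>i\<in>UNIV.
     convex_conjugate (\<lambda>s. ereal (rho \<psi> s)) (u $ i)
       - ereal (u $ i * (norm (x - \<xi> $ i))\<^sup>2) + indicator_fun (D i) (\<xi> $ i))"

text \<open>Stationarity for the unconstrained problem; the sum is the Minkowski sum of sets from
  \<^theory>\<open>HOL-Library.Set_Algebras\<close>.\<close>

definition stationary_point ::
    "(real \<Rightarrow> real) \<Rightarrow> ('m::finite \<Rightarrow> 'a::euclidean_space set) \<Rightarrow> 'a \<Rightarrow> bool" where
  "stationary_point \<psi> D x \<longleftrightarrow>
     0 \<in> (\<Sum>i\<in>UNIV. (\<lambda>p. (2 * right_deriv \<psi> ((infdist x (D i))\<^sup>2)) *\<^sub>R (x - p)) ` proj_set (D i) x)"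


section \<open>The algorithm\<close>

definition gp_argmin :: "'a::euclidean_space set \<Rightarrow> 'a \<Rightarrow> 'a \<Rightarrow> real \<Rightarrow> 'a \<Rightarrow> bool" where
  "gp_argmin C g y \<alpha> u \<longleftrightarrow>
     is_arg_min (\<lambda>u. inner g (u - y) + 1 / (2 * \<alpha>) * (norm (u - y))\<^sup>2) (\<lambda>u. u \<in> C) u"

text \<open>\<open>line_search F C \<eta> \<sigma> r g y \<alpha> u\<close>: the inner loop for the objective \<open>F\<close> with reference value
  \<open>r\<close>, run at the iterate \<open>y\<close> with direction \<open>g\<close> and current step size \<open>\<alpha>\<close>, can stop
  (after finitely many reductions) with the accepted point \<open>u\<close>.\<close>

inductive line_search :: "('a::euclidean_space \<Rightarrow> real) \<Rightarrow> 'a set \<Rightarrow> real \<Rightarrow> real \<Rightarrow> real \<Rightarrow>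
    'a \<Rightarrow> 'a \<Rightarrow> real \<Rightarrow> 'a \<Rightarrow> bool"
  for F C \<eta> \<sigma> r g y where
  accept: "gp_argmin C g y \<alpha> u \<Longrightarrow> F u - r \<le> - (\<sigma> / 2) * (norm (u - y))\<^sup>2 \<Longrightarrow>
     line_search F C \<eta> \<sigma> r g y \<alpha> u"
| reduce: "gp_argmin C g y \<alpha> v \<Longrightarrow> \<not> F v - r \<le> - (\<sigma> / 2) * (norm (v - y))\<^sup>2 \<Longrightarrow>
     line_search F C \<eta> \<sigma> r g y (\<eta> * \<alpha>) u \<Longrightarrow> line_search F C \<eta> \<sigma> r g y \<alpha> u"

text \<open>\<open>x\<close> is an (infinite) sequence of outer iterates for some admissible outcome of all the free
  choices. The truncated subtraction \<open>t - M\<close> is \<open>max {t - M, 0}\<close>.\<close>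

definition sGP_ls_sequence :: "(real \<Rightarrow> real) \<Rightarrow> ('m::finite \<Rightarrow> 'a::euclidean_space set) \<Rightarrow> 'a set \<Rightarrow>
    real \<Rightarrow> real \<Rightarrow> real \<Rightarrow> real \<Rightarrow> nat \<Rightarrow> (nat \<Rightarrow> 'a) \<Rightarrow> bool" where
  "sGP_ls_sequence \<psi> D C \<alpha>min \<alpha>max \<eta> \<sigma> M x \<longleftrightarrow>
     0 < \<alpha>min \<and> \<alpha>min < \<alpha>max \<and> 0 < \<eta> \<and> \<eta> < 1 \<and> 0 < \<sigma> \<and> x 0 \<in> C \<and>
     (\<forall>t. \<exists>\<alpha>0 \<xi>. \<alpha>0 \<in> {\<alpha>min..\<alpha>max} \<and> (\<forall>i. \<xi> i \<in> proj_set (D i) (x t)) \<and>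
        line_search (Psi \<psi> D) C \<eta> \<sigma> (Max ((\<lambda>i. Psi \<psi> D (x i)) ` {t - M..t}))
          (2 *\<^sub>R (\<Sum>i\<in>UNIV. right_deriv \<psi> ((infdist (x t) (D i))\<^sup>2) *\<^sub>R (x t - \<xi> i)))
          (x t) \<alpha>0 (x (Suc t)))"

end

theory Submission
  imports Defs
begin

text \<open>
  Lift an iterate \<open>x\<^sup>t\<close> with its projections \<open>\<xi>\<^sup>t\<close> to \<open>z\<^sup>t = (x\<^sup>t, \<xi>\<^sup>t, u\<^sup>t)\<close>, where
  \<open>u\<^sub>i\<^sup>t = - \<psi>'\<^sub>+(d\<^sub>i\<^sup>2(x\<^sup>t))\<close>. Fenchel's equality makes the value of \<open>M\<close> at \<open>z\<^sup>t\<close> equal to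
  \<open>\<Psi>(x\<^sup>t)\<close>, and \<open>(g\<^sup>t, 0, 0)\<close> is a regular subgradient of \<open>M\<close> at the very same point, so that no
  index shift occurs. Concavity of \<open>\<psi>\<close> gives a global descent inequality for \<open>\<Psi>\<close> and hence a lower
  bound on the accepted step sizes, i.e. \<open>\<parallel>g\<^sup>t\<parallel>\<close> is at most a multiple of \<open>\<parallel>x\<^sup>t\<^sup>+\<^sup>1 - x\<^sup>t\<parallel>\<close>. The KL
  inequality therefore bounds \<open>\<parallel>x\<^sup>t\<^sup>+\<^sup>1 - x\<^sup>t\<parallel>\<close> by the decrease of \<open>\<phi>(\<Psi>(x\<^sup>t) - lim \<Psi>)\<close> whenever \<open>z\<^sup>t\<close> is
  near an accumulation point. As the projections may jump between different accumulation points, the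
  functions \<open>\<phi>\<close> of a finite subcover are added; telescoping shows that \<open>x\<^sup>t\<close> has finite length.
\<close>

section \<open>The class \<open>\<Theta>\<close> and the conjugate of \<open>\<rho>\<close>\<close>

lemma concave_below_tangent:
  fixes f :: "real \<Rightarrow> real"
  assumes "concave_on S f" "c \<in> interior S" "s \<in> S" "f differentiable (at c)"
  shows "f s \<le> f c + deriv f c * (s - c)"
proof -
  have "convex_on S (\<lambda>s. - f s)"
    using assms(1) by (simp add: concave_on_def)
  moreover have "connected S"
    using assms(1) concave_on_imp_convex convex_connected by blast
  moreover have "((\<lambda>s. - f s) has_field_derivative - deriv f c) (at c within S)"
    using assms(4) by (intro DERIV_minus DERIV_subset[OF DERIV_deriv_iff_real_differentiable[THEN iffD2]]) auto
  ultimately have "- f s - - f c \<ge> - deriv f c * (s - c)"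
    using assms(2,3) by (intro convex_on_imp_above_tangent) auto
  then show ?thesis by simp
qed

lemma right_deriv_eqI:
  assumes "(f has_real_derivative d) (at_right s)"
  shows "right_deriv f s = d"
  unfolding right_deriv_def
proof (rule the_equality, rule assms)
  fix e assume "(f has_real_derivative e) (at_right s)"
  then show "e = d"
    using assms unfolding has_field_derivative_iff
    by (rule tendsto_unique[OF trivial_limit_at_right_real])
qed

lemma Theta_nonneg: "\<psi> \<in> Theta \<Longrightarrow> 0 \<le> s \<Longrightarrow> 0 \<le> \<psi> s"
  and Theta_zero: "\<psi> \<in> Theta \<Longrightarrow> \<psi> 0 = 0"
  and Theta_level_bounded: "\<psi> \<in> Theta \<Longrightarrow> bounded {s. s \<ge> 0 \<and> \<psi> s \<le> \<gamma>}"
  and Theta_continuous: "\<psi> \<in> Theta \<Longrightarrow> continuous_on {0..} \<psi>"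
  and Theta_concave: "\<psi> \<in> Theta \<Longrightarrow> concave_on {0..} \<psi>"
  and Theta_right_deriv_lipschitz: "\<psi> \<in> Theta \<Longrightarrow> \<exists>L. L-lipschitz_on {0..} (right_deriv \<psi>)"
  and Theta_deriv_tendsto: "\<psi> \<in> Theta \<Longrightarrow> \<exists>c>0. (deriv \<psi> \<longlongrightarrow> c) (at_right 0)"
  and Theta_differentiable: "\<psi> \<in> Theta \<Longrightarrow> 0 < s \<Longrightarrow> \<psi> differentiable (at s)"
  and Theta_deriv_pos: "\<psi> \<in> Theta \<Longrightarrow> 0 < s \<Longrightarrow> 0 < deriv \<psi> s"
  unfolding Theta_def C1_pos_deriv_on_def by auto

lemma Theta_right_deriv_eq_deriv:
  assumes "\<psi> \<in> Theta" "0 < s"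
  shows "right_deriv \<psi> s = deriv \<psi> s"
  using Theta_differentiable[OF assms]
  by (intro right_deriv_eqI)
     (meson DERIV_deriv_iff_real_differentiable has_field_derivative_at_within)

lemma Theta_tendsto_0:
  assumes "\<psi> \<in> Theta"
  shows "(\<psi> \<longlongrightarrow> 0) (at_right 0)"
proof -
  have "(\<psi> \<longlongrightarrow> \<psi> 0) (at 0 within {0..})"
    using Theta_continuous[OF assms] by (auto simp: continuous_on)
  then have "(\<psi> \<longlongrightarrow> \<psi> 0) (at_right 0)"
    by (rule tendsto_within_subset) auto
  then show ?thesis by (simp add: Theta_zero[OF assms])
qed

text \<open>L'Hopital's rule applied to \<open>\<psi> x / x\<close> identifies the limit of the
  derivative, which \<open>Theta\<close> provides, with the right derivative at 0; the numerator
  tends to 0 by continuity and \<open>\<psi> 0 = 0\<close>.\<close>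

lemma Theta_deriv_tendsto_right_deriv:
  assumes "\<psi> \<in> Theta"
  shows "(deriv \<psi> \<longlongrightarrow> right_deriv \<psi> 0) (at_right 0)" and "0 < right_deriv \<psi> 0"
proof -
  obtain c where c: "c > 0" "(deriv \<psi> \<longlongrightarrow> c) (at_right 0)"
    using Theta_deriv_tendsto[OF assms] by blast
  have pos: "eventually (\<lambda>x::real. 0 < x) (at_right 0)"
    by (simp add: eventually_at_right_less)
  have "((\<lambda>x. \<psi> x / x) \<longlongrightarrow> c) (at_right 0)"
  proof (rule lhopital_right_0[where f' = "deriv \<psi>" and g' = "\<lambda>_. 1"])
    show "eventually (\<lambda>x. DERIV \<psi> x :> deriv \<psi> x) (at_right 0)"
      using pos by eventually_elim
        (use Theta_differentiable[OF assms] DERIV_deriv_iff_real_differentiable in blast)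
  qed (use pos c Theta_tendsto_0[OF assms] in \<open>auto elim: eventually_mono\<close>)
  then have "(\<psi> has_real_derivative c) (at_right 0)"
    by (simp add: has_field_derivative_iff Theta_zero[OF assms])
  then have "right_deriv \<psi> 0 = c" by (rule right_deriv_eqI)
  with c show "(deriv \<psi> \<longlongrightarrow> right_deriv \<psi> 0) (at_right 0)" "0 < right_deriv \<psi> 0" by auto
qed

lemma Theta_right_deriv_pos: "\<psi> \<in> Theta \<Longrightarrow> 0 \<le> s \<Longrightarrow> 0 < right_deriv \<psi> s"
  by (cases "s = 0")
     (use Theta_deriv_tendsto_right_deriv Theta_right_deriv_eq_deriv Theta_deriv_pos in auto)

text \<open>At \<open>s > 0\<close> this is the tangent inequality at an interior point. The
  endpoint \<open>s = 0\<close> follows by letting the point of tangency decrease to 0.\<close>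

lemma Theta_below_tangent:
  assumes "\<psi> \<in> Theta" "0 \<le> s" "0 \<le> s'"
  shows "\<psi> s' \<le> \<psi> s + right_deriv \<psi> s * (s' - s)"
proof -
  have pos: "\<psi> s' \<le> \<psi> s + deriv \<psi> s * (s' - s)" if "0 < s" for s
    using assms that
    by (intro concave_below_tangent[OF Theta_concave]) (auto simp: Theta_differentiable)
  show ?thesis
  proof (cases "s = 0")
    case False
    then show ?thesis
      using pos assms by (simp add: Theta_right_deriv_eq_deriv)
  next
    case True
    have "\<psi> s' \<le> 0 + right_deriv \<psi> 0 * (s' - 0)"
    proof (rule tendsto_lowerbound)
      show "((\<lambda>s. \<psi> s + deriv \<psi> s * (s' - s)) \<longlongrightarrow> 0 + right_deriv \<psi> 0 * (s' - 0)) (at_right 0)"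
        by (intro tendsto_intros Theta_tendsto_0 Theta_deriv_tendsto_right_deriv assms)
      show "eventually (\<lambda>s. \<psi> s' \<le> \<psi> s + deriv \<psi> s * (s' - s)) (at_right 0)"
        using eventually_at_right_less[of "0::real"] by eventually_elim (rule pos)
    qed simp
    then show ?thesis using True by (simp add: Theta_zero[OF assms(1)])
  qed
qed

text \<open>Adding the tangent inequalities at the two points gives monotonicity, with the endpoint
  0 included.\<close>

lemma Theta_right_deriv_antimono:
  assumes "\<psi> \<in> Theta" "0 \<le> s" "s \<le> s'"
  shows "right_deriv \<psi> s' \<le> right_deriv \<psi> s"
proof (cases "s = s'")
  case False
  have "0 \<le> (right_deriv \<psi> s - right_deriv \<psi> s') * (s' - s)"
    using Theta_below_tangent[of \<psi> s s'] Theta_below_tangent[of \<psi> s' s] assms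
    by (simp add: algebra_simps)
  with False assms show ?thesis
    by (simp add: zero_le_mult_iff)
qed simp

lemma Theta_continuous_right_deriv:
  "\<psi> \<in> Theta \<Longrightarrow> continuous_on {0..} (right_deriv \<psi>)"
  using Theta_right_deriv_lipschitz lipschitz_on_continuous_on by blast

section \<open>Fenchel's inequality and its equality case\<close>

lemma conjugate_rho_ge:
  assumes "0 \<le> s"
  shows "ereal (v * s + \<psi> s) \<le> convex_conjugate (\<lambda>s. ereal (rho \<psi> s)) v"
proof -
  have "ereal (inner v s) - ereal (rho \<psi> s) \<le> convex_conjugate (\<lambda>s. ereal (rho \<psi> s)) v"
    unfolding convex_conjugate_def by (rule SUP_upper) simp
  then show ?thesis using assms by (simp add: rho_def)
qed

text \<open>The supremum defining the conjugate is attained at \<open>s\<close>: against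
  \<open>r \<ge> 0\<close> this is the tangent inequality at \<open>s\<close>, and against
  \<open>r < 0\<close> the value of the conjugate is nonnegative while the competitor is
  nonpositive.\<close>

lemma conjugate_rho_neg_right_deriv:
  assumes "\<psi> \<in> Theta" "0 \<le> s"
  shows "convex_conjugate (\<lambda>s. ereal (rho \<psi> s)) (- right_deriv \<psi> s)
    = ereal (\<psi> s - right_deriv \<psi> s * s)"
proof (rule antisym)
  have "- right_deriv \<psi> s * r - rho \<psi> r \<le> \<psi> s - right_deriv \<psi> s * s" for r
  proof (cases "0 \<le> r")
    case True
    then show ?thesis
      using Theta_below_tangent[OF assms(1,2), of r] by (simp add: rho_def algebra_simps)
  next
    case False
    \<comment> \<open>The competitor equals
      \<open>(right_deriv \<psi> 0 - right_deriv \<psi> s) * r - r^2\<close>, and the bracket is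
      nonnegative.\<close>
    have "right_deriv \<psi> 0 * r \<le> right_deriv \<psi> s * r"
      using False Theta_right_deriv_antimono[of \<psi> 0 s] assms by (simp add: mult_right_mono_neg)
    moreover have "0 \<le> \<psi> s - right_deriv \<psi> s * s"
      using Theta_below_tangent[of \<psi> s 0] assms by (simp add: Theta_zero)
    moreover have "rho \<psi> r = r\<^sup>2 - right_deriv \<psi> 0 * r"
      using False by (simp add: rho_def)
    moreover have "0 \<le> r\<^sup>2" by simp
    ultimately show ?thesis by linarith
  qed
  then show "convex_conjugate (\<lambda>s. ereal (rho \<psi> s)) (- right_deriv \<psi> s)
    \<le> ereal (\<psi> s - right_deriv \<psi> s * s)"
    unfolding convex_conjugate_def by (intro SUP_least) simp
  show "ereal (\<psi> s - right_deriv \<psi> s * s)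
    \<le> convex_conjugate (\<lambda>s. ereal (rho \<psi> s)) (- right_deriv \<psi> s)"
    using conjugate_rho_ge[OF assms(2), of "- right_deriv \<psi> s" \<psi>] by (simp add: algebra_simps)
qed

section \<open>Finite length\<close>

text \<open>Plays the role of the uniformized KL property.\<close>

lemma summable_telescoping_cover:
  fixes z :: "nat \<Rightarrow> 'a::topological_space" and \<delta> :: "nat \<Rightarrow> real"
  assumes K: "compact K" "\<And>t. z t \<in> K" and nonneg: "\<And>t. 0 \<le> \<delta> t"
    and local: "\<And>p. p \<in> K \<Longrightarrow> \<exists>N q. open N \<and> p \<in> N \<and>
      (\<forall>\<^sub>F t in sequentially. (0::real) \<le> q t \<and> q (Suc t) \<le> q t \<and>
         (z t \<in> N \<longrightarrow> \<delta> t \<le> q t - q (Suc t)))"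
  shows "summable \<delta>"
proof -
  define good where "good p N q \<longleftrightarrow> open N \<and> p \<in> N \<and>
      (\<forall>\<^sub>F t in sequentially. (0::real) \<le> q t \<and> q (Suc t) \<le> q t \<and>
         (z t \<in> N \<longrightarrow> \<delta> t \<le> q t - q (Suc t)))" for p N q
  have "\<forall>p\<in>K. \<exists>N q. good p N q"
    using local unfolding good_def by blast
  then obtain N q where "\<forall>p\<in>K. good p (N p) (q p)"
    unfolding bchoice_iff by blast
  then have N: "\<And>p. p \<in> K \<Longrightarrow> open (N p)" "\<And>p. p \<in> K \<Longrightarrow> p \<in> N p"
    and ev: "\<And>p. p \<in> K \<Longrightarrow> \<forall>\<^sub>F t in sequentially. 0 \<le> q p t \<and> q p (Suc t) \<le> q p t \<and>
         (z t \<in> N p \<longrightarrow> \<delta> t \<le> q p t - q p (Suc t))"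
    by (simp_all add: good_def)
  obtain F where F: "F \<subseteq> K" "finite F" "K \<subseteq> (\<Union>p\<in>F. N p)"
    using compactE_image[OF K(1), of K N] N by blast
  define Q where "Q t = (\<Sum>p\<in>F. q p t)" for t
  have "\<forall>\<^sub>F t in sequentially. \<forall>p\<in>F. 0 \<le> q p t \<and> q p (Suc t) \<le> q p t \<and>
         (z t \<in> N p \<longrightarrow> \<delta> t \<le> q p t - q p (Suc t))"
    using F ev by (intro eventually_ball_finite) auto
  then obtain T where T: "\<And>t p. t \<ge> T \<Longrightarrow> p \<in> F \<Longrightarrow> 0 \<le> q p t \<and> q p (Suc t) \<le> q p t \<and>
         (z t \<in> N p \<longrightarrow> \<delta> t \<le> q p t - q p (Suc t))"
    unfolding eventually_sequentially by blast
  have step: "\<delta> t \<le> Q t - Q (Suc t)" if t: "t \<ge> T" for t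
  proof -
    obtain p where p: "p \<in> F" "z t \<in> N p" using F(3) K(2) by blast
    then have "\<delta> t \<le> q p t - q p (Suc t)" using T t by blast
    \<comment> \<open>All summands are nonnegative, also those whose neighbourhood misses
      \<open>z t\<close>. This is why monotonicity of \<open>q\<close> is demanded independently of
      \<open>z t \<in> N\<close>.\<close>
    also have "\<dots> \<le> (\<Sum>p\<in>F. q p t - q p (Suc t))"
      using T[OF t] p F(2) by (intro member_le_sum) auto
    finally show ?thesis by (simp add: Q_def sum_subtractf)
  qed
  have "summable (\<lambda>t. \<delta> (t + T))"
  proof (rule bounded_imp_summable[where B = "Q T"])
    fix n
    have "(\<Sum>k\<le>n. \<delta> (k + T)) \<le> Q T - Q (Suc n + T)"
    proof (induction n)
      case 0
      then show ?case using step[of T] by simp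
    next
      case (Suc n)
      then show ?case using step[of "Suc n + T"] by simp
    qed
    moreover have "0 \<le> Q (Suc n + T)"
      unfolding Q_def using T by (intro sum_nonneg) auto
    ultimately show "(\<Sum>k\<le>n. \<delta> (k + T)) \<le> Q T" by linarith
  qed (use nonneg in auto)
  then show ?thesis by (simp add: summable_iff_shift)
qed

text \<open>Concavity puts \<phi> below its tangent at \<open>r\<close>, so the derivative at the
  larger value controls the drop from \<open>r\<close> to \<open>r'\<close>.\<close>

lemma Xi_increment:
  assumes "\<phi> \<in> Xi \<nu>" "0 \<le> r'" "r' \<le> r" "0 < r" "ereal r < \<nu>"
  shows "0 < deriv \<phi> r" and "deriv \<phi> r * (r - r') \<le> \<phi> r - \<phi> r'"
proof -
  let ?S = "{s. 0 \<le> s \<and> ereal s < \<nu>}"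
  have *: "concave_on ?S \<phi>" "C1_pos_deriv_on \<phi> {s. 0 < s \<and> ereal s < \<nu>}"
    using assms(1) by (auto simp: Xi_def)
  then show "0 < deriv \<phi> r"
    using assms by (auto simp: C1_pos_deriv_on_def)
  \<comment> \<open>An intermediate real \<open>b\<close> gives an open interval around
    \<open>r\<close> inside the domain, whether \<nu> is finite or not.\<close>
  obtain b where b: "r < b" "ereal b < \<nu>"
    using ereal_dense2[OF assms(5)] by auto
  have "{0<..<b} \<subseteq> ?S"
    using b(2) by (auto intro: order.strict_trans[of "ereal _" "ereal b"])
  then have "r \<in> interior ?S"
    using assms(4) b(1) by (intro interiorI[of "{0<..<b}"]) auto
  moreover have "r' \<in> ?S"
    using assms by (auto intro: le_less_trans[of "ereal r'" "ereal r"])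
  ultimately have "\<phi> r' \<le> \<phi> r + deriv \<phi> r * (r' - r)"
    using * assms by (intro concave_below_tangent) (auto simp: C1_pos_deriv_on_def)
  then show "deriv \<phi> r * (r - r') \<le> \<phi> r - \<phi> r'"
    by (simp add: algebra_simps)
qed

section \<open>Subgradients of the lifted function and the descent inequality\<close>

definition lift_point :: "(real \<Rightarrow> real) \<Rightarrow> ('m::finite \<Rightarrow> 'a::euclidean_space set) \<Rightarrow> 'a \<Rightarrow> ('m \<Rightarrow> 'a)
    \<Rightarrow> 'a \<times> ('a ^ 'm) \<times> (real ^ 'm)" where
  "lift_point \<psi> D x \<xi> = (x, (\<chi> i. \<xi> i), (\<chi> i. - right_deriv \<psi> ((infdist x (D i))\<^sup>2)))"

text \<open>This is the direction used by the algorithm. The projections may be non-unique, so it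
  depends on the selection \<xi> and not on \<open>x\<close> alone.\<close>

definition Psi_grad :: "(real \<Rightarrow> real) \<Rightarrow> ('m::finite \<Rightarrow> 'a::euclidean_space set) \<Rightarrow> 'a \<Rightarrow> ('m \<Rightarrow> 'a)
    \<Rightarrow> 'a" where
  "Psi_grad \<psi> D x \<xi> = 2 *\<^sub>R (\<Sum>i\<in>UNIV. right_deriv \<psi> ((infdist x (D i))\<^sup>2) *\<^sub>R (x - \<xi> i))"

lemma proj_setD:
  assumes "y \<in> proj_set A x"
  shows "y \<in> A" "norm (x - y) = infdist x A"
  using assms by (auto simp: proj_set_def dist_norm)

lemma frakM_lift_point:
  assumes "\<psi> \<in> Theta" "\<And>i. \<xi> i \<in> proj_set (D i) x"
  shows "frakM \<psi> D (lift_point \<psi> D x \<xi>) = ereal (Psi \<psi> D x)"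
  using assms proj_setD[OF assms(2)]
  by (simp add: frakM_def lift_point_def Psi_def conjugate_rho_neg_right_deriv indicator_fun_def)

text \<open>Fenchel's inequality is applied with freely chosen \<open>s i\<close>. Taking for
  \<open>s i\<close> the squared distances at a fixed lifted point turns the right factor into a
  difference of squared distances, which vanishes at that point.\<close>

lemma frakM_ge:
  assumes "\<And>i. \<xi> $ i \<in> D i" "\<And>i. 0 \<le> s i"
  shows "ereal (\<Sum>i\<in>UNIV. \<psi> (s i) + u $ i * (s i - (norm (x - \<xi> $ i))\<^sup>2)) \<le> frakM \<psi> D (x, \<xi>, u)"
proof -
  have "ereal (\<psi> (s i) + u $ i * (s i - (norm (x - \<xi> $ i))\<^sup>2))
    \<le> convex_conjugate (\<lambda>s. ereal (rho \<psi> s)) (u $ i)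
       - ereal (u $ i * (norm (x - \<xi> $ i))\<^sup>2) + indicator_fun (D i) (\<xi> $ i)" for i
    using ereal_minus_mono[OF conjugate_rho_ge[OF assms(2)[of i], of "u $ i" \<psi>]
        order_refl[of "ereal (u $ i * (norm (x - \<xi> $ i))\<^sup>2)"]] assms(1)[of i]
    by (simp add: indicator_fun_def algebra_simps)
  then show ?thesis
    unfolding frakM_def by (simp flip: sum_ereal add: sum_mono)
qed

lemma frakM_eq_PInf: "\<xi> $ j \<notin> D j \<Longrightarrow> frakM \<psi> D (x, \<xi>, u) = \<infinity>"
  by (auto simp: frakM_def sum_Pinfty indicator_fun_def)

text \<open>The hypothesis \<open>norm (x - y) \<le> norm (x - y')\<close> holds for a projection \<open>y\<close> of \<open>x\<close>; it is what
  cancels the first-order dependence on \<open>y'\<close>.\<close>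

lemma distance_term_lower_bound:
  fixes x y x' y' :: "'a::real_inner"
  assumes "u \<le> 0" "norm (x - y) \<le> norm (x - y')"
    and "norm (x' - x) \<le> \<delta>" "norm (y' - y) \<le> \<delta>" "\<bar>u' - u\<bar> \<le> \<delta>" "\<delta> \<le> 1"
  shows "- 2 * u * inner (x - y) (x' - x) - (- 2 * u + 4 * norm (x - y) + 4) * \<delta>\<^sup>2
    \<le> u' * ((norm (x - y))\<^sup>2 - (norm (x' - y'))\<^sup>2)"
proof -
  define p p' where "p = norm (x - y)" and "p' = norm (x' - y')"
  have \<delta>: "0 \<le> \<delta>" using assms(3) norm_ge_zero order_trans by blast
  have "p\<^sup>2 \<le> (norm (x - y'))\<^sup>2"
    unfolding p_def using assms(2) by (simp add: power_mono)
  moreover have "p'\<^sup>2 = (norm (x - y'))\<^sup>2 + 2 * inner (x - y') (x' - x) + (norm (x' - x))\<^sup>2"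
    unfolding p'_def power2_norm_eq_inner by (simp add: inner_diff inner_commute)
  moreover have "inner (x - y') (x' - x) = inner (x - y) (x' - x) - inner (y' - y) (x' - x)"
    by (simp add: inner_diff)
  moreover have "inner (y' - y) (x' - x) \<le> \<delta>\<^sup>2"
  proof -
    have "inner (y' - y) (x' - x) \<le> norm (y' - y) * norm (x' - x)" by (rule norm_cauchy_schwarz)
    also have "\<dots> \<le> \<delta> * \<delta>" using assms \<delta> by (intro mult_mono) auto
    finally show ?thesis by (simp add: power2_eq_square)
  qed
  ultimately have "2 * inner (x - y) (x' - x) - 2 * \<delta>\<^sup>2 \<le> p'\<^sup>2 - p\<^sup>2"
    using zero_le_power2[of "norm (x' - x)"] by linarith
  \<comment> \<open>Split \<open>u' * (p^2 - p'^2)\<close> into \<open>u * (p^2 - p'^2)\<close>,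
    bounded here by the sign of \<open>u\<close> and the projection inequality, and
    \<open>(u' - u) * (p^2 - p'^2)\<close>, bounded in \<open>2\<close> as a product of two factors
    of order \<delta>. The errors \<open>- 2 * u\<close> and \<open>2 * (2 * p + 2)\<close>, each
    times \<open>\<delta>^2\<close>, add up to the stated constant.\<close>
  then have 1: "(- u) * (2 * inner (x - y) (x' - x) - 2 * \<delta>\<^sup>2) \<le> (- u) * (p'\<^sup>2 - p\<^sup>2)"
    using assms(1) by (intro mult_left_mono) auto
  have "norm ((x - y) - (x' - y')) \<le> norm (x' - x) + norm (y' - y)"
    using norm_triangle_ineq4[of "y' - y" "x' - x"] by (simp add: algebra_simps)
  then have p: "\<bar>p - p'\<bar> \<le> 2 * \<delta>"
    unfolding p_def p'_def using norm_triangle_ineq3[of "x - y" "x' - y'"] assms(3,4) by linarith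
  have "\<bar>p\<^sup>2 - p'\<^sup>2\<bar> = \<bar>p - p'\<bar> * \<bar>p + p'\<bar>"
    unfolding abs_mult[symmetric] by (simp add: power2_eq_square algebra_simps)
  \<comment> \<open>Since \<open>p'\<close> exceeds \<open>p\<close> by at most
    \<open>2 * \<delta>\<close> and \<open>\<delta> \<le> 1\<close>, the sum \<open>p + p'\<close>
    is at most \<open>2 * p + 2\<close>.\<close>
  also have "\<dots> \<le> (2 * \<delta>) * (2 * p + 2)"
    using p assms(6) \<delta> by (intro mult_mono) (auto simp: p_def p'_def)
  finally have "\<bar>p\<^sup>2 - p'\<^sup>2\<bar> \<le> (2 * \<delta>) * (2 * p + 2)" .
  then have "\<bar>u' - u\<bar> * \<bar>p\<^sup>2 - p'\<^sup>2\<bar> \<le> \<delta> * ((2 * \<delta>) * (2 * p + 2))"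
    using assms(5) \<delta> by (intro mult_mono) auto
  then have 2: "- (\<delta> * ((2 * \<delta>) * (2 * p + 2))) \<le> (u' - u) * (p\<^sup>2 - p'\<^sup>2)"
    unfolding abs_mult[symmetric] by linarith
  show ?thesis
    using 1 2 unfolding p_def[symmetric] p'_def[symmetric]
    by (simp add: algebra_simps power2_eq_square)
qed

text \<open>To first order only \<open>x\<close> matters: each \<xi> component minimises the
  distance over \<open>D i\<close>, and each \<open>u\<close> component attains Fenchel's equality.
  The remaining error is quadratic, and points with an infeasible \<xi> component have value
  \<infinity>.\<close>

lemma frakM_lift_point_lower_bound:
  assumes \<psi>: "\<psi> \<in> Theta" and \<xi>: "\<And>i. \<xi> i \<in> proj_set (D i) x"
  obtains K where "\<And>z. norm (z - lift_point \<psi> D x \<xi>) \<le> 1 \<Longrightarrow>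
    ereal (Psi \<psi> D x + inner (Psi_grad \<psi> D x \<xi>, 0, 0) (z - lift_point \<psi> D x \<xi>)
      - K * (norm (z - lift_point \<psi> D x \<xi>))\<^sup>2) \<le> frakM \<psi> D z"
proof
  define a where "a i = right_deriv \<psi> ((infdist x (D i))\<^sup>2)" for i
  define K where "K = (\<Sum>i\<in>UNIV. 2 * a i + 4 * norm (x - \<xi> i) + 4)"
  fix z :: "'b \<times> ('b ^ 'a) \<times> (real ^ 'a)"
  define \<delta> where "\<delta> = norm (z - lift_point \<psi> D x \<xi>)"
  assume "norm (z - lift_point \<psi> D x \<xi>) \<le> 1"
  then have \<delta>1: "\<delta> \<le> 1" by (simp add: \<delta>_def)
  obtain x' \<xi>' u' where z: "z = (x', \<xi>', u')" by (cases z)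
  have bnd: "norm (x' - x) \<le> \<delta>" "norm (\<xi>' $ i - \<xi> i) \<le> \<delta>" "\<bar>u' $ i - - a i\<bar> \<le> \<delta>" for i
  proof -
    have d: "z - lift_point \<psi> D x \<xi> = (x' - x, \<xi>' - (\<chi> i. \<xi> i), u' - (\<chi> i. - a i))"
      by (simp add: z lift_point_def a_def)
    show "norm (x' - x) \<le> \<delta>"
      unfolding \<delta>_def d by (rule norm_fst_le)
    have "norm (\<xi>' - (\<chi> i. \<xi> i)) \<le> \<delta>" "norm (u' - (\<chi> i. - a i)) \<le> \<delta>"
      unfolding \<delta>_def d
      by (meson norm_fst_le norm_snd_le order_trans)+
    then show "norm (\<xi>' $ i - \<xi> i) \<le> \<delta>" "\<bar>u' $ i - - a i\<bar> \<le> \<delta>"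
      using Finite_Cartesian_Product.norm_nth_le[of "\<xi>' - (\<chi> i. \<xi> i)" i]
        Finite_Cartesian_Product.norm_nth_le[of "u' - (\<chi> i. - a i)" i] by simp_all
  qed
  have inner: "inner (Psi_grad \<psi> D x \<xi>, 0, 0) (z - lift_point \<psi> D x \<xi>)
    = (\<Sum>i\<in>UNIV. 2 * a i * inner (x - \<xi> i) (x' - x))"
    by (simp add: Psi_grad_def z lift_point_def a_def inner_sum_left sum_distrib_left mult.assoc)
  show "ereal (Psi \<psi> D x + inner (Psi_grad \<psi> D x \<xi>, 0, 0) (z - lift_point \<psi> D x \<xi>)
      - K * (norm (z - lift_point \<psi> D x \<xi>))\<^sup>2) \<le> frakM \<psi> D z"
  proof (cases "\<forall>i. \<xi>' $ i \<in> D i")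
    case True
    have "2 * a i * inner (x - \<xi> i) (x' - x) - (2 * a i + 4 * norm (x - \<xi> i) + 4) * \<delta>\<^sup>2
      \<le> u' $ i * ((norm (x - \<xi> i))\<^sup>2 - (norm (x' - \<xi>' $ i))\<^sup>2)" for i
    proof -
      have "0 < a i" unfolding a_def by (intro Theta_right_deriv_pos \<psi>) simp
      moreover have "norm (x - \<xi> i) \<le> norm (x - \<xi>' $ i)"
        using proj_setD(2)[OF \<xi>] infdist_le[of "\<xi>' $ i" "D i" x] True by (simp add: dist_norm)
      ultimately show ?thesis
        using distance_term_lower_bound[of "- a i" x "\<xi> i" "\<xi>' $ i" x' \<delta> "u' $ i"] bnd \<delta>1
        by simp
    qed
    then have "(\<Sum>i\<in>UNIV. \<psi> ((norm (x - \<xi> i))\<^sup>2) + (2 * a i * inner (x - \<xi> i) (x' - x)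
          - (2 * a i + 4 * norm (x - \<xi> i) + 4) * \<delta>\<^sup>2))
      \<le> (\<Sum>i\<in>UNIV. \<psi> ((norm (x - \<xi> i))\<^sup>2)
            + u' $ i * ((norm (x - \<xi> i))\<^sup>2 - (norm (x' - \<xi>' $ i))\<^sup>2))"
      by (intro sum_mono add_left_mono)
    moreover have "Psi \<psi> D x + inner (Psi_grad \<psi> D x \<xi>, 0, 0) (z - lift_point \<psi> D x \<xi>) - K * \<delta>\<^sup>2
      = (\<Sum>i\<in>UNIV. \<psi> ((norm (x - \<xi> i))\<^sup>2) + (2 * a i * inner (x - \<xi> i) (x' - x)
          - (2 * a i + 4 * norm (x - \<xi> i) + 4) * \<delta>\<^sup>2))"
      unfolding inner K_def Psi_def proj_setD(2)[OF \<xi>] sum_distrib_right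
      by (subst sum.distrib, subst sum_subtractf) simp
    ultimately have "ereal (Psi \<psi> D x + inner (Psi_grad \<psi> D x \<xi>, 0, 0) (z - lift_point \<psi> D x \<xi>)
        - K * \<delta>\<^sup>2) \<le> ereal (\<Sum>i\<in>UNIV. \<psi> ((norm (x - \<xi> i))\<^sup>2)
            + u' $ i * ((norm (x - \<xi> i))\<^sup>2 - (norm (x' - \<xi>' $ i))\<^sup>2))"
      by simp
    also have "\<dots> \<le> frakM \<psi> D z"
      unfolding z using True by (intro frakM_ge) auto
    finally show ?thesis by (simp add: \<delta>_def)
  next
    case False
    then show ?thesis by (auto simp: z frakM_eq_PInf)
  qed
qed

text \<open>By the quadratic minorant, the difference quotient near the lifted point is at least
  \<open>- K * norm (z - ?z)\<close>, which tends to 0.\<close>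

lemma regular_subdiff_frakM:
  assumes "\<psi> \<in> Theta" "\<And>i. \<xi> i \<in> proj_set (D i) x"
  shows "(Psi_grad \<psi> D x \<xi>, 0, 0) \<in> regular_subdiff (frakM \<psi> D) (lift_point \<psi> D x \<xi>)"
proof -
  let ?z = "lift_point \<psi> D x \<xi>" and ?f = "frakM \<psi> D" and ?v = "(Psi_grad \<psi> D x \<xi>, 0, 0)"
  obtain K where K: "\<And>z. norm (z - ?z) \<le> 1 \<Longrightarrow>
      ereal (Psi \<psi> D x + inner ?v (z - ?z) - K * (norm (z - ?z))\<^sup>2) \<le> ?f z"
    using frakM_lift_point_lower_bound[where \<psi> = \<psi> and D = D and x = x and \<xi> = \<xi>] assms by blast
  have val: "?f ?z = ereal (Psi \<psi> D x)" using frakM_lift_point[of \<psi> \<xi> D x] assms by auto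
  have "((\<lambda>z. ereal (- K * norm (z - ?z))) \<longlongrightarrow> ereal (- K * norm (?z - ?z))) (at ?z)"
    by (intro tendsto_intros)
  then have "Liminf (at ?z) (\<lambda>z. ereal (- K * norm (z - ?z))) = 0"
    by (intro lim_imp_Liminf) (simp_all add: zero_ereal_def)
  moreover have "Liminf (at ?z) (\<lambda>z. ereal (- K * norm (z - ?z)))
    \<le> Liminf (at ?z) (\<lambda>z. (?f z - ?f ?z - ereal (inner ?v (z - ?z))) / ereal (norm (z - ?z)))"
  proof (rule Liminf_mono)
    have "\<forall>\<^sub>F z in at ?z. z \<noteq> ?z \<and> norm (z - ?z) < 1"
      unfolding eventually_at dist_norm by (intro exI[of _ 1]) auto
    then show "\<forall>\<^sub>F z in at ?z. ereal (- K * norm (z - ?z))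
      \<le> (?f z - ?f ?z - ereal (inner ?v (z - ?z))) / ereal (norm (z - ?z))"
    proof eventually_elim
      case (elim z)
      have "ereal (norm (z - ?z) * (- K * norm (z - ?z))) \<le> ?f z - ?f ?z - ereal (inner ?v (z - ?z))"
        unfolding val using K[of z] elim
        by (cases "?f z") (auto simp: power2_eq_square algebra_simps)
      then show ?case
        using elim by (subst ereal_le_divide_pos) auto
    qed
  qed
  ultimately show ?thesis
    by (simp add: regular_subdiff_def edomain_def val)
qed

lemma regular_subset_limiting_subdiff: "regular_subdiff f z \<subseteq> limiting_subdiff f z"
proof
  fix v assume v: "v \<in> regular_subdiff f z"
  then have "z \<in> edomain f" by (auto simp: regular_subdiff_def split: if_splits)
  with v show "v \<in> limiting_subdiff f z"
    unfolding limiting_subdiff_def if_P[OF \<open>z \<in> edomain f\<close>]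
    by (intro CollectI exI[of _ "\<lambda>_. z"] exI[of _ "\<lambda>_. v"]) simp
qed

text \<open>The squared distance from \<open>v\<close> to \<open>D i\<close> is at most that from
  \<open>v\<close> to the fixed point \<open>\<xi> i\<close>, with equality at \<open>v = y\<close>.
  Composing with the tangent of \<psi> yields a quadratic majorant; its curvature is uniform because
  the right derivative is largest at 0.\<close>

lemma Psi_descent:
  fixes D :: "'m::finite \<Rightarrow> 'a::euclidean_space set"
  assumes \<psi>: "\<psi> \<in> Theta" and \<xi>: "\<And>i. \<xi> i \<in> proj_set (D i) y"
  shows "Psi \<psi> D v \<le> Psi \<psi> D y + inner (Psi_grad \<psi> D y \<xi>) (v - y)
    + real CARD('m) * right_deriv \<psi> 0 * (norm (v - y))\<^sup>2"
proof -
  define a where "a i = right_deriv \<psi> ((infdist y (D i))\<^sup>2)" for i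
  have "\<psi> ((infdist v (D i))\<^sup>2) \<le> \<psi> ((infdist y (D i))\<^sup>2) + 2 * a i * inner (y - \<xi> i) (v - y)
      + right_deriv \<psi> 0 * (norm (v - y))\<^sup>2" for i
  proof -
    have a: "0 < a i" "a i \<le> right_deriv \<psi> 0"
      unfolding a_def by (auto intro!: Theta_right_deriv_pos Theta_right_deriv_antimono \<psi>)
    have "(infdist v (D i))\<^sup>2 \<le> (norm (v - \<xi> i))\<^sup>2"
      using infdist_le[OF proj_setD(1)[OF \<xi>], of v i]
      by (intro power_mono) (auto simp: dist_norm infdist_nonneg)
    also have "\<dots> = (norm (y - \<xi> i))\<^sup>2 + 2 * inner (y - \<xi> i) (v - y) + (norm (v - y))\<^sup>2"
      unfolding power2_norm_eq_inner by (simp add: inner_diff inner_commute)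
    finally have "(infdist v (D i))\<^sup>2 - (infdist y (D i))\<^sup>2
        \<le> 2 * inner (y - \<xi> i) (v - y) + (norm (v - y))\<^sup>2"
      by (simp add: proj_setD(2)[OF \<xi>])
    then have "a i * ((infdist v (D i))\<^sup>2 - (infdist y (D i))\<^sup>2)
        \<le> a i * (2 * inner (y - \<xi> i) (v - y)) + a i * (norm (v - y))\<^sup>2"
      using a(1) unfolding distrib_left[symmetric] by (intro mult_left_mono) auto
    moreover have "a i * (norm (v - y))\<^sup>2 \<le> right_deriv \<psi> 0 * (norm (v - y))\<^sup>2"
      using a(2) by (intro mult_right_mono) auto
    moreover have "\<psi> ((infdist v (D i))\<^sup>2) \<le> \<psi> ((infdist y (D i))\<^sup>2)
        + a i * ((infdist v (D i))\<^sup>2 - (infdist y (D i))\<^sup>2)"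
      unfolding a_def by (intro Theta_below_tangent \<psi>) auto
    ultimately show ?thesis by simp
  qed
  then have "Psi \<psi> D v \<le> (\<Sum>i\<in>UNIV. \<psi> ((infdist y (D i))\<^sup>2) + 2 * a i * inner (y - \<xi> i) (v - y)
      + right_deriv \<psi> 0 * (norm (v - y))\<^sup>2)"
    unfolding Psi_def by (intro sum_mono)
  also have "\<dots> = Psi \<psi> D y + inner (Psi_grad \<psi> D y \<xi>) (v - y)
    + real CARD('m) * right_deriv \<psi> 0 * (norm (v - y))\<^sup>2"
    by (simp add: sum.distrib Psi_def Psi_grad_def a_def inner_sum_left sum_distrib_left mult.assoc)
  finally show ?thesis .
qed

section \<open>The unconstrained gradient step and the line search\<close>

lemma gp_argmin_UNIV:
  assumes "gp_argmin UNIV g y \<alpha> u" "0 < \<alpha>"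
  shows "u = y - \<alpha> *\<^sub>R g"
proof -
  \<comment> \<open>Completing the square shows that the model is minimised exactly where
    \<open>v - y + \<alpha> *\<^sub>R g\<close> vanishes.\<close>
  have sq: "inner g (v - y) + 1 / (2 * \<alpha>) * (norm (v - y))\<^sup>2
      = 1 / (2 * \<alpha>) * (norm (v - y + \<alpha> *\<^sub>R g))\<^sup>2 - \<alpha> / 2 * (norm g)\<^sup>2" for v
  proof -
    have "(norm (v - y + \<alpha> *\<^sub>R g))\<^sup>2 = (norm (v - y))\<^sup>2 + 2 * \<alpha> * inner g (v - y) + \<alpha>\<^sup>2 * (norm g)\<^sup>2"
      unfolding power2_norm_eq_inner
      by (simp add: inner_add inner_commute power2_eq_square algebra_simps)
    then show ?thesis using assms(2) by (simp add: field_simps power2_eq_square)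
  qed
  have "\<not> (inner g (y - \<alpha> *\<^sub>R g - y) + 1 / (2 * \<alpha>) * (norm (y - \<alpha> *\<^sub>R g - y))\<^sup>2
    < inner g (u - y) + 1 / (2 * \<alpha>) * (norm (u - y))\<^sup>2)"
    using assms(1) unfolding gp_argmin_def is_arg_min_def by blast
  then have "1 / (2 * \<alpha>) * (norm (u - y + \<alpha> *\<^sub>R g))\<^sup>2 \<le> 0"
    unfolding sq by simp
  then have "u - y + \<alpha> *\<^sub>R g = 0"
    using assms(2) by (simp add: divide_le_0_iff)
  then show ?thesis by (simp add: algebra_simps)
qed

text \<open>A rejected step size exceeds \<open>1 / (L + \<sigma> / 2)\<close>, so the next trial is
  at least \<eta> times this number. Induction over the inner loop carries the bound to the accepted
  \<beta>.\<close>

lemma line_search_step: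
  assumes "line_search F UNIV \<eta> \<sigma> r g y \<alpha> u" "0 < \<alpha>" "0 < \<eta>" "0 < \<sigma>" "0 \<le> L"
    and descent: "\<And>v. F v \<le> r + inner g (v - y) + L * (norm (v - y))\<^sup>2"
  shows "\<exists>\<beta>\<ge>min \<alpha> (\<eta> / (L + \<sigma> / 2)). u = y - \<beta> *\<^sub>R g \<and> F u \<le> r - \<sigma> / 2 * (norm (u - y))\<^sup>2"
  using assms(1,2)
proof induction
  case (accept \<alpha> u)
  then show ?case using gp_argmin_UNIV[of g y \<alpha> u] by (intro exI[of _ \<alpha>]) auto
next
  case (reduce \<alpha> v u)
  have v: "v = y - \<alpha> *\<^sub>R g" using gp_argmin_UNIV reduce by blast
  have pos: "0 < L + \<sigma> / 2" using assms by simp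
  \<comment> \<open>Otherwise the descent inequality at \<open>v\<close>, whose linear term is
    \<open>- \<alpha> * (norm g)^2\<close>, would already imply the acceptance test.\<close>
  have "1 < \<alpha> * (L + \<sigma> / 2)"
  proof (rule ccontr)
    assume "\<not> ?thesis"
    then have "(\<alpha> * (norm g)\<^sup>2) * (\<alpha> * (L + \<sigma> / 2)) \<le> (\<alpha> * (norm g)\<^sup>2) * 1"
      using reduce.prems by (intro mult_left_mono) auto
    moreover have "(norm (v - y))\<^sup>2 = \<alpha>\<^sup>2 * (norm g)\<^sup>2" "inner g (v - y) = - \<alpha> * (norm g)\<^sup>2"
      by (simp_all add: v power_mult_distrib power2_norm_eq_inner)
    ultimately have "F v - r \<le> - (\<sigma> / 2) * (norm (v - y))\<^sup>2"
      using descent[of v] by (simp add: power2_eq_square algebra_simps)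
    with reduce.hyps show False by blast
  qed
  then have "\<eta> / (L + \<sigma> / 2) \<le> \<eta> * \<alpha>"
    using pos assms(3) mult_left_mono[of 1 "\<alpha> * (L + \<sigma> / 2)" \<eta>]
    by (simp add: pos_divide_le_eq mult.assoc)
  moreover obtain \<beta> where "\<beta> \<ge> min (\<eta> * \<alpha>) (\<eta> / (L + \<sigma> / 2))" "u = y - \<beta> *\<^sub>R g"
      "F u \<le> r - \<sigma> / 2 * (norm (u - y))\<^sup>2"
    using reduce.IH reduce.prems assms(3) by auto
  ultimately show ?case by (intro exI[of _ \<beta>]) auto
qed

section \<open>Compactness and convergence\<close>

text \<open>Along an unbounded sequence in the sublevel set the distances to every
  \<open>D i\<close> stay bounded. A limit of the normalised points is therefore a unit vector lying
  in all horizon cones.\<close>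

lemma bounded_Psi_sublevel:
  fixes D :: "'m::finite \<Rightarrow> 'a::euclidean_space set"
  assumes D: "\<And>i. D i \<noteq> {}" "\<And>i. closed (D i)"
    and horizon: "(\<Inter>i. horizon_cone (D i)) = {0}" and \<psi>: "\<psi> \<in> Theta"
  shows "bounded {x. Psi \<psi> D x \<le> \<gamma>}"
proof (rule ccontr)
  assume "\<not> ?thesis"
  then have "\<forall>k. \<exists>x. Psi \<psi> D x \<le> \<gamma> \<and> real (Suc k) < norm x"
    unfolding bounded_iff by (auto simp: not_le)
  then obtain x where x: "\<And>k. Psi \<psi> D (x k) \<le> \<gamma>" "\<And>k. real (Suc k) < norm (x k)"
    by metis
  have pos: "0 < norm (x k)" for k using x(2)[of k] by linarith
  \<comment> \<open>Level-boundedness of \<psi> turns the bound on each summand of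
    \<open>Psi\<close> into a bound on the squared distance.\<close>
  obtain B where B: "\<And>s. 0 \<le> s \<Longrightarrow> \<psi> s \<le> \<gamma> \<Longrightarrow> s \<le> B"
    using Theta_level_bounded[OF \<psi>, of \<gamma>] unfolding bounded_iff by fastforce
  have dB: "infdist (x k) (D i) \<le> sqrt B" for k i
  proof -
    have "\<psi> ((infdist (x k) (D i))\<^sup>2) \<le> Psi \<psi> D (x k)"
      unfolding Psi_def by (intro member_le_sum) (auto intro: Theta_nonneg \<psi>)
    then have "(infdist (x k) (D i))\<^sup>2 \<le> B"
      using x(1)[of k] by (intro B) auto
    then show ?thesis by (simp add: real_le_rsqrt)
  qed
  have "\<forall>k i. \<exists>y. y \<in> D i \<and> infdist (x k) (D i) = dist (x k) y"
    using infdist_attains_inf[OF D(2) D(1)] by metis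
  then obtain y where y: "\<And>k i. y k i \<in> D i" "\<And>k i. infdist (x k) (D i) = dist (x k) (y k i)"
    unfolding choice_iff by blast
  define w where "w k = x k /\<^sub>R norm (x k)" for k
  have "\<forall>k. w k \<in> sphere 0 1"
    unfolding w_def using pos by (auto simp: norm_divide)
  then obtain l r where l: "l \<in> sphere 0 1" and r: "strict_mono (r :: nat \<Rightarrow> nat)" "(w \<circ> r) \<longlonglongrightarrow> l"
    using compact_sphere[of "0::'a" 1] unfolding compact_def by meson
  define c where "c k = 1 / norm (x (r k))" for k
  have c: "c \<longlonglongrightarrow> 0"
  proof (rule tendsto_sandwich[OF _ _ tendsto_const LIMSEQ_inverse_real_of_nat])
    have "c k \<le> inverse (real (Suc k))" for k
      unfolding c_def inverse_eq_divide using x(2)[of "r k"] seq_suble[OF r(1), of k]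
      by (intro frac_le) auto
    then show "\<forall>\<^sub>F k in sequentially. c k \<le> inverse (real (Suc k))" by simp
  qed (simp add: c_def)
  have "l \<in> horizon_cone (D i)" for i
  proof -
    \<comment> \<open>The projections stay within bounded distance of the iterates, so scaling by
      \<open>c k\<close> erases the difference and both scaled sequences tend to
      \<open>l\<close>.\<close>
    have "(\<lambda>k. c k *\<^sub>R (x (r k) - y (r k) i)) \<longlonglongrightarrow> 0"
    proof (rule Lim_null_comparison)
      show "\<forall>\<^sub>F k in sequentially. norm (c k *\<^sub>R (x (r k) - y (r k) i)) \<le> c k * sqrt B"
        using dB y(2) by (auto simp: c_def dist_norm[symmetric] divide_right_mono)
      show "(\<lambda>k. c k * sqrt B) \<longlonglongrightarrow> 0"
        using tendsto_mult_right[OF c, of "sqrt B"] by simp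
    qed
    then have "(\<lambda>k. (w \<circ> r) k - c k *\<^sub>R (x (r k) - y (r k) i)) \<longlonglongrightarrow> l - 0"
      by (intro tendsto_diff r(2))
    moreover have "(w \<circ> r) k - c k *\<^sub>R (x (r k) - y (r k) i) = c k *\<^sub>R y (r k) i" for k
      by (simp add: w_def c_def algebra_simps inverse_eq_divide)
    ultimately have "(\<lambda>k. c k *\<^sub>R y (r k) i) \<longlonglongrightarrow> l" by simp
    moreover have "\<forall>k. 0 < c k" using pos by (simp add: c_def)
    ultimately show ?thesis
      unfolding horizon_cone_def using y(1) c
      by (intro CollectI exI[of _ "\<lambda>k. y (r k) i"] exI[of _ c]) blast
  qed
  then have "l = 0" using horizon by auto
  with l show False by simp
qed

section \<open>Lifted sequences: boundedness, limits and the KL inequality\<close>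

lemma bounded_vec:
  fixes f :: "'b \<Rightarrow> 'a::real_normed_vector ^ 'm::finite"
  assumes "\<And>i. bounded (range (\<lambda>t. f t $ i))"
  shows "bounded (range f)"
proof -
  have "\<exists>B. \<forall>t. norm (f t $ i) \<le> B" for i
    using assms[of i] by (auto simp: bounded_iff)
  then obtain B where B: "\<And>i t. norm (f t $ i) \<le> B i" by metis
  have "norm (f t) \<le> (\<Sum>i\<in>UNIV. B i)" for t
    unfolding norm_vec_def by (rule order_trans[OF L2_set_le_sum]) (auto intro: sum_mono B)
  then show ?thesis by (auto simp: bounded_iff)
qed

lemma bounded_lift_points:
  fixes D :: "'m::finite \<Rightarrow> 'a::euclidean_space set"
  assumes \<psi>: "\<psi> \<in> Theta" and \<xi>: "\<And>t i. \<xi> t i \<in> proj_set (D i) (x t)"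
    and x: "bounded (range x)"
  shows "bounded (range (\<lambda>t. lift_point \<psi> D (x t) (\<xi> t)))"
proof -
  obtain B where B: "\<And>t. norm (x t) \<le> B" using x by (auto simp: bounded_iff)
  have "bounded (range (\<lambda>t. \<chi> i. \<xi> t i))"
  proof (rule bounded_vec)
    fix i
    \<comment> \<open>One \<open>B\<close> bounds \<open>x t\<close> itself, the other the growth of
      the 1-Lipschitz distance function between 0 and \<open>x t\<close>.\<close>
    have "norm (\<xi> t i) \<le> infdist 0 (D i) + B + B" for t
    proof -
      have "norm (\<xi> t i) \<le> norm (x t) + norm (x t - \<xi> t i)"
        by (metis norm_triangle_sub norm_minus_commute)
      moreover have "norm (x t - \<xi> t i) \<le> infdist 0 (D i) + norm (x t)"
        unfolding proj_setD(2)[OF \<xi>] using infdist_triangle[of "x t" "D i" 0] by simp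
      ultimately show ?thesis using B[of t] by linarith
    qed
    then show "bounded (range (\<lambda>t. (\<chi> i. \<xi> t i) $ i))" by (auto simp: bounded_iff)
  qed
  moreover have "bounded (range (\<lambda>t. \<chi> i. - right_deriv \<psi> ((infdist (x t) (D i))\<^sup>2)))"
  proof (rule bounded_vec)
    fix i
    have "\<bar>right_deriv \<psi> s\<bar> \<le> right_deriv \<psi> 0" if "0 \<le> s" for s
      using Theta_right_deriv_pos[OF \<psi> that] Theta_right_deriv_antimono[OF \<psi> _ that] by simp
    then show "bounded (range (\<lambda>t. (\<chi> i. - right_deriv \<psi> ((infdist (x t) (D i))\<^sup>2)) $ i))"
      unfolding bounded_iff by (intro exI[of _ "right_deriv \<psi> 0"]) auto
  qed
  ultimately have "bounded (range x \<times> range (\<lambda>t. \<chi> i. \<xi> t i) \<times>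
      range (\<lambda>t. \<chi> i. - right_deriv \<psi> ((infdist (x t) (D i))\<^sup>2)))"
    by (intro bounded_Times x)
  then show ?thesis
    by (rule bounded_subset) (auto simp: lift_point_def)
qed

lemma tendsto_right_deriv_infdist:
  assumes "\<psi> \<in> Theta" "X \<longlonglongrightarrow> y"
  shows "(\<lambda>k. right_deriv \<psi> ((infdist (X k) A)\<^sup>2)) \<longlonglongrightarrow> right_deriv \<psi> ((infdist y A)\<^sup>2)"
  by (rule continuous_on_tendsto_compose[OF Theta_continuous_right_deriv[OF assms(1)]])
     (simp_all add: tendsto_power tendsto_infdist assms(2))

lemma tendsto_Psi:
  assumes "\<psi> \<in> Theta" "X \<longlonglongrightarrow> y"
  shows "(\<lambda>k. Psi \<psi> D (X k)) \<longlonglongrightarrow> Psi \<psi> D y"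
  unfolding Psi_def
  by (rule tendsto_sum, rule continuous_on_tendsto_compose[OF Theta_continuous[OF assms(1)]])
     (simp_all add: tendsto_power tendsto_infdist assms(2))

text \<open>Limits of projections are projections of the limit, by closedness of \<open>D i\<close>
  and continuity of the distance, and the right derivative of \<psi> is continuous. Accumulation
  points of lifted points are thus lifted points again, which makes the KL property available
  there.\<close>

lemma lift_point_limit:
  fixes D :: "'m::finite \<Rightarrow> 'a::euclidean_space set"
  assumes \<psi>: "\<psi> \<in> Theta" and D: "\<And>i. closed (D i)"
    and \<xi>: "\<And>k i. \<xi> k i \<in> proj_set (D i) (X k)"
    and lim: "(\<lambda>k. lift_point \<psi> D (X k) (\<xi> k)) \<longlonglongrightarrow> p"
  obtains y \<zeta> where "p = lift_point \<psi> D y \<zeta>" "\<And>i. \<zeta> i \<in> proj_set (D i) y" "X \<longlonglongrightarrow> y"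
    "(\<lambda>k. Psi_grad \<psi> D (X k) (\<xi> k)) \<longlonglongrightarrow> Psi_grad \<psi> D y \<zeta>"
proof -
  obtain y v u where p: "p = (y, v, u)" by (cases p)
  have X: "X \<longlonglongrightarrow> y"
    using tendsto_fst[OF lim] by (simp add: p lift_point_def)
  have "(\<lambda>k. \<chi> i. \<xi> k i) \<longlonglongrightarrow> v"
    using tendsto_fst[OF tendsto_snd[OF lim]] by (simp add: p lift_point_def)
  then have \<xi>_lim: "(\<lambda>k. \<xi> k i) \<longlonglongrightarrow> v $ i" for i
    using tendsto_vec_nth[of "\<lambda>k. \<chi> i. \<xi> k i" v sequentially i] by simp
  have "(\<lambda>k. \<chi> i. - right_deriv \<psi> ((infdist (X k) (D i))\<^sup>2)) \<longlonglongrightarrow> u"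
    using tendsto_snd[OF tendsto_snd[OF lim]] by (simp add: p lift_point_def)
  then have "(\<lambda>k. - right_deriv \<psi> ((infdist (X k) (D i))\<^sup>2)) \<longlonglongrightarrow> u $ i" for i
    using tendsto_vec_nth[of "\<lambda>k. \<chi> i. - right_deriv \<psi> ((infdist (X k) (D i))\<^sup>2)" u sequentially i]
    by simp
  then have u: "u $ i = - right_deriv \<psi> ((infdist y (D i))\<^sup>2)" for i
    using LIMSEQ_unique tendsto_minus[OF tendsto_right_deriv_infdist[OF \<psi> X]] by blast
  have \<zeta>: "v $ i \<in> proj_set (D i) y" for i
  proof -
    have "v $ i \<in> D i"
      using closed_sequentially[OF D _ \<xi>_lim] proj_setD(1)[OF \<xi>] by blast
    moreover have "(\<lambda>k. dist (X k) (\<xi> k i)) \<longlonglongrightarrow> dist y (v $ i)"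
      by (intro tendsto_dist X \<xi>_lim)
    moreover have "(\<lambda>k. dist (X k) (\<xi> k i)) \<longlonglongrightarrow> infdist y (D i)"
      using tendsto_infdist[OF X, of "D i"] \<xi> by (simp add: proj_set_def)
    ultimately show ?thesis
      using LIMSEQ_unique by (auto simp: proj_set_def)
  qed
  have "p = lift_point \<psi> D y (\<lambda>i. v $ i)"
    by (simp add: p lift_point_def vec_eq_iff u)
  moreover have "(\<lambda>k. Psi_grad \<psi> D (X k) (\<xi> k)) \<longlonglongrightarrow> Psi_grad \<psi> D y (\<lambda>i. v $ i)"
    unfolding Psi_grad_def by (intro tendsto_intros tendsto_right_deriv_infdist X \<xi>_lim \<psi>)
  ultimately show thesis using that[of y "\<lambda>i. v $ i"] X \<zeta> by blast
qed

text \<open>On lifted points \<open>frakM\<close> takes the values of \<open>Psi\<close>, and the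
  distance of 0 to the subdifferential is at most the norm of one subgradient, the one given by
  \<open>Psi_grad\<close>. The KL inequality thus becomes a statement about \<open>Psi\<close> and
  \<open>Psi_grad\<close> alone.\<close>

lemma KL_gradient_bound:
  fixes D :: "'m::finite \<Rightarrow> 'a::euclidean_space set"
  assumes \<psi>: "\<psi> \<in> Theta" and KL: "KL_function (frakM \<psi> D)"
    and \<zeta>: "\<And>i. \<zeta> i \<in> proj_set (D i) y"
  obtains N \<nu> \<phi> where "open N" "lift_point \<psi> D y \<zeta> \<in> N" "0 < \<nu>" "\<phi> \<in> Xi \<nu>"
    "\<forall>x \<xi>. (\<forall>i. \<xi> i \<in> proj_set (D i) x) \<and> lift_point \<psi> D x \<xi> \<in> N \<and>
      0 < Psi \<psi> D x - Psi \<psi> D y \<and> ereal (Psi \<psi> D x - Psi \<psi> D y) < \<nu> \<longrightarrow>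
      1 \<le> deriv \<phi> (Psi \<psi> D x - Psi \<psi> D y) * norm (Psi_grad \<psi> D x \<xi>)"
proof -
  let ?f = "frakM \<psi> D" and ?z = "lift_point \<psi> D y \<zeta>"
  have sub: "(Psi_grad \<psi> D x \<xi>, 0, 0) \<in> limiting_subdiff ?f (lift_point \<psi> D x \<xi>)"
    if "\<And>i. \<xi> i \<in> proj_set (D i) x" for x \<xi>
    using regular_subdiff_frakM[where \<psi> = \<psi> and D = D and x = x and \<xi> = \<xi>] \<psi> that
      regular_subset_limiting_subdiff by blast
  have val: "?f (lift_point \<psi> D x \<xi>) = ereal (Psi \<psi> D x)"
    if "\<And>i. \<xi> i \<in> proj_set (D i) x" for x \<xi>
    using frakM_lift_point[of \<psi> \<xi> D x] \<psi> that by blast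
  have "limiting_subdiff ?f ?z \<noteq> {}" using sub[OF \<zeta>] by blast
  then have "KL_at ?f ?z" using KL unfolding KL_function_def by blast
  then obtain N \<nu> \<phi> where N: "open N" "?z \<in> N" "0 < \<nu>" "\<phi> \<in> Xi \<nu>"
    and ineq: "\<And>z. z \<in> N \<Longrightarrow> ?f ?z < ?f z \<Longrightarrow> ?f z < ?f ?z + \<nu> \<Longrightarrow>
      1 \<le> ereal (deriv \<phi> (real_of_ereal (?f z - ?f ?z))) * edist_set 0 (limiting_subdiff ?f z)"
    unfolding KL_at_def by blast
  show thesis
  proof (rule that[OF N], intro allI impI, elim conjE)
    fix x \<xi>
    let ?r = "Psi \<psi> D x - Psi \<psi> D y" and ?x = "lift_point \<psi> D x \<xi>"
    assume "\<forall>i. \<xi> i \<in> proj_set (D i) x" and x: "?x \<in> N" and r: "0 < ?r" "ereal ?r < \<nu>"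
    then have \<xi>: "\<xi> i \<in> proj_set (D i) x" for i by blast
    have "ereal (Psi \<psi> D x) < ereal (Psi \<psi> D y) + \<nu>"
      using r by (cases \<nu>) auto
    then have "1 \<le> ereal (deriv \<phi> ?r) * edist_set 0 (limiting_subdiff ?f ?x)"
      using ineq[OF x] r unfolding val[OF \<xi>] val[OF \<zeta>] by simp
    also have "edist_set 0 (limiting_subdiff ?f ?x) \<le> ereal (norm (Psi_grad \<psi> D x \<xi>))"
      unfolding edist_set_def by (rule INF_lower2[OF sub[OF \<xi>]]) (simp add: norm_prod_def)
    then have "ereal (deriv \<phi> ?r) * edist_set 0 (limiting_subdiff ?f ?x)
        \<le> ereal (deriv \<phi> ?r) * ereal (norm (Psi_grad \<psi> D x \<xi>))"
      \<comment> \<open>Only the positivity of the derivative is taken from this instance.\<close>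
      using Xi_increment(1)[OF N(4), of ?r ?r] r by (intro ereal_mult_left_mono) auto
    finally show "1 \<le> deriv \<phi> ?r * norm (Psi_grad \<psi> D x \<xi>)"
      by (simp add: one_ereal_def)
  qed
qed

lemma stationary_point_if_Psi_grad_eq_0:
  fixes D :: "'m::finite \<Rightarrow> 'a::euclidean_space set"
  assumes "\<And>i. \<zeta> i \<in> proj_set (D i) y" "Psi_grad \<psi> D y \<zeta> = 0"
  shows "stationary_point \<psi> D y"
proof -
  let ?s = "\<lambda>i. (2 * right_deriv \<psi> ((infdist y (D i))\<^sup>2)) *\<^sub>R (y - \<zeta> i)"
  have "(\<Sum>i\<in>UNIV. ?s i) = 0"
    using assms(2) by (simp add: Psi_grad_def scaleR_sum_right flip: scaleR_scaleR)
  then show ?thesis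
    unfolding stationary_point_def set_sum_alt[OF finite]
    using assms(1) by (auto intro!: exI[of _ ?s])
qed

section \<open>Progress of the algorithm and convergence\<close>

lemma sGP_ls_sequence_progress:
  fixes D :: "'m::finite \<Rightarrow> 'a::euclidean_space set"
  assumes \<psi>: "\<psi> \<in> Theta" and seq: "sGP_ls_sequence \<psi> D UNIV \<alpha>min \<alpha>max \<eta> \<sigma> 0 x"
  obtains \<xi> c where "0 < c" "\<And>t i. \<xi> t i \<in> proj_set (D i) (x t)"
    "\<And>t. c * norm (Psi_grad \<psi> D (x t) (\<xi> t)) \<le> norm (x (Suc t) - x t)"
    "\<And>t. Psi \<psi> D (x (Suc t)) \<le> Psi \<psi> D (x t) - \<sigma> / 2 * (norm (x (Suc t) - x t))\<^sup>2"
proof -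
  \<comment> \<open>With \<open>M = 0\<close> the maximum runs over the single index
    \<open>t\<close>, so the reference value is \<open>Psi \<psi> D (x t)\<close>.\<close>
  have par: "0 < \<alpha>min" "0 < \<eta>" "0 < \<sigma>"
    and step: "\<forall>t. \<exists>\<alpha>0 \<xi>. \<alpha>0 \<in> {\<alpha>min..\<alpha>max} \<and> (\<forall>i. \<xi> i \<in> proj_set (D i) (x t)) \<and>
        line_search (Psi \<psi> D) UNIV \<eta> \<sigma> (Psi \<psi> D (x t)) (Psi_grad \<psi> D (x t) \<xi>) (x t) \<alpha>0 (x (Suc t))"
    using seq by (auto simp: sGP_ls_sequence_def Psi_grad_def)
  obtain \<alpha> \<xi> where \<alpha>: "\<And>t. \<alpha> t \<in> {\<alpha>min..\<alpha>max}" and \<xi>: "\<And>t i. \<xi> t i \<in> proj_set (D i) (x t)"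
    and ls: "\<And>t. line_search (Psi \<psi> D) UNIV \<eta> \<sigma> (Psi \<psi> D (x t)) (Psi_grad \<psi> D (x t) (\<xi> t))
       (x t) (\<alpha> t) (x (Suc t))"
    using step unfolding choice_iff by blast
  define L where "L = real CARD('m) * right_deriv \<psi> 0"
  have L: "0 \<le> L" unfolding L_def using Theta_right_deriv_pos[OF \<psi>, of 0] by simp
  \<comment> \<open>A lower bound, uniform in \<open>t\<close>, for the accepted step sizes.\<close>
  define c where "c = min \<alpha>min (\<eta> / (L + \<sigma> / 2))"
  have prog: "c * norm (Psi_grad \<psi> D (x t) (\<xi> t)) \<le> norm (x (Suc t) - x t) \<and>
      Psi \<psi> D (x (Suc t)) \<le> Psi \<psi> D (x t) - \<sigma> / 2 * (norm (x (Suc t) - x t))\<^sup>2" for t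
  proof -
    have "\<exists>\<beta>\<ge>min (\<alpha> t) (\<eta> / (L + \<sigma> / 2)). x (Suc t) = x t - \<beta> *\<^sub>R Psi_grad \<psi> D (x t) (\<xi> t) \<and>
        Psi \<psi> D (x (Suc t)) \<le> Psi \<psi> D (x t) - \<sigma> / 2 * (norm (x (Suc t) - x t))\<^sup>2"
      using par L \<alpha>[of t] Psi_descent[OF \<psi> \<xi>]
      by (intro line_search_step[OF ls]) (auto simp: L_def)
    then obtain \<beta> where \<beta>: "\<beta> \<ge> min (\<alpha> t) (\<eta> / (L + \<sigma> / 2))"
        "x (Suc t) = x t - \<beta> *\<^sub>R Psi_grad \<psi> D (x t) (\<xi> t)"
        "Psi \<psi> D (x (Suc t)) \<le> Psi \<psi> D (x t) - \<sigma> / 2 * (norm (x (Suc t) - x t))\<^sup>2"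
      by blast
    have "c \<le> \<bar>\<beta>\<bar>" using \<beta>(1) \<alpha>[of t] by (auto simp: c_def min_def split: if_splits)
    then have "c * norm (Psi_grad \<psi> D (x t) (\<xi> t)) \<le> \<bar>\<beta>\<bar> * norm (Psi_grad \<psi> D (x t) (\<xi> t))"
      by (intro mult_right_mono) auto
    also have "\<dots> = norm (x (Suc t) - x t)" unfolding \<beta>(2) by simp
    finally show ?thesis using \<beta>(3) by blast
  qed
  moreover have "0 < c" using par L by (simp add: c_def)
  ultimately show thesis using that \<xi> by blast
qed

theorem theorem5p4:
  fixes D :: "'m::finite \<Rightarrow> (real ^ 'n::finite) set"
    and \<psi> :: "real \<Rightarrow> real"
    and \<alpha>min \<alpha>max \<eta> \<sigma> :: real
    and x :: "nat \<Rightarrow> real ^ 'n"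
  assumes "\<And>i. D i \<noteq> {}" and "\<And>i. closed (D i)"
    and "(\<Inter>i. horizon_cone (D i)) = {0}"
    and "\<psi> \<in> Theta"
    and "KL_function (frakM \<psi> D)"
    and "sGP_ls_sequence \<psi> D UNIV \<alpha>min \<alpha>max \<eta> \<sigma> 0 x"
  shows "\<exists>xbar. x \<longlonglongrightarrow> xbar \<and> stationary_point \<psi> D xbar"
proof -
  note \<psi> = \<open>\<psi> \<in> Theta\<close>
  have \<sigma>: "0 < \<sigma>" using assms(6) by (simp add: sGP_ls_sequence_def)
  obtain \<xi> c where c: "0 < c" and \<xi>: "\<And>t i. \<xi> t i \<in> proj_set (D i) (x t)"
    and step: "\<And>t. c * norm (Psi_grad \<psi> D (x t) (\<xi> t)) \<le> norm (x (Suc t) - x t)"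
    and desc: "\<And>t. Psi \<psi> D (x (Suc t)) \<le> Psi \<psi> D (x t) - \<sigma> / 2 * (norm (x (Suc t) - x t))\<^sup>2"
    by (rule sGP_ls_sequence_progress[OF \<psi> assms(6)]) (rule that)
  define P z g where "P t = Psi \<psi> D (x t)" and "z t = lift_point \<psi> D (x t) (\<xi> t)"
    and "g t = Psi_grad \<psi> D (x t) (\<xi> t)" for t
  define \<Delta> where "\<Delta> t = norm (x (Suc t) - x t)" for t
  have P_Suc: "P (Suc t) \<le> P t - \<sigma> / 2 * (\<Delta> t)\<^sup>2" for t
    using desc[of t] by (simp add: P_def \<Delta>_def)
  have P_dec: "P (Suc t) \<le> P t" for t
  proof -
    have "0 \<le> \<sigma> / 2 * (\<Delta> t)\<^sup>2" using \<sigma> by simp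
    then show ?thesis using P_Suc[of t] by linarith
  qed
  then have dec: "decseq P" by (simp add: decseq_Suc_iff)
  have "0 \<le> P t" for t
    unfolding P_def Psi_def by (intro sum_nonneg) (simp add: Theta_nonneg[OF \<psi>])
  then obtain L where L: "P \<longlonglongrightarrow> L" "\<And>t. L \<le> P t"
    using decseq_convergent[OF dec] by blast
  \<comment> \<open>Monotonicity confines the iterates to the initial sublevel set, which is bounded
    by the horizon cone condition.\<close>
  have "P t \<le> P 0" for t using dec by (simp add: decseq_def)
  then have "range x \<subseteq> {y. Psi \<psi> D y \<le> P 0}" by (auto simp: P_def)
  then have "bounded (range x)"
    using bounded_Psi_sublevel[OF assms(1-4)] bounded_subset by blast
  then have bdd: "bounded (range z)"
    unfolding z_def by (rule bounded_lift_points[OF \<psi> \<xi>])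
  \<comment> \<open>The factor collects the constants of sufficient decrease
    (\<open>\<sigma> / 2\<close>) and of the gradient bound (\<open>c\<close>), so that the KL
    inequality yields exactly the decrease of \<phi>.\<close>
  have "summable (\<lambda>t. \<sigma> * c / 2 * \<Delta> t)"
  proof (rule summable_telescoping_cover)
    show "compact (closure (range z))" using bdd by simp
    show "z t \<in> closure (range z)" for t by (rule subsetD[OF closure_subset rangeI])
    show "0 \<le> \<sigma> * c / 2 * \<Delta> t" for t using \<sigma> c by (simp add: \<Delta>_def)
    fix p
    show "\<exists>N q. open N \<and> p \<in> N \<and> (\<forall>\<^sub>F t in sequentially. (0::real) \<le> q t \<and> q (Suc t) \<le> q t \<and>
         (z t \<in> N \<longrightarrow> \<sigma> * c / 2 * \<Delta> t \<le> q t - q (Suc t)))"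
    \<comment> \<open>If some neighbourhood of \<open>p\<close> is eventually avoided, the zero
      function serves as \<open>q\<close>. Otherwise \<open>p\<close> is an accumulation point of
      \<open>z\<close>.\<close>
    proof (cases "\<exists>N. open N \<and> p \<in> N \<and> (\<forall>\<^sub>F t in sequentially. z t \<notin> N)")
      case True
      then obtain N where "open N" "p \<in> N" "\<forall>\<^sub>F t in sequentially. z t \<notin> N" by blast
      then show ?thesis
        by (intro exI[of _ N] exI[of _ "\<lambda>_. 0"]) (auto elim: eventually_mono)
    next
      case False
      have "\<forall>k. \<exists>t\<ge>k. dist (z t) p < inverse (real (Suc k))"
      proof
        fix k
        have "\<not> (\<forall>\<^sub>F t in sequentially. z t \<notin> ball p (inverse (real (Suc k))))"
          using False by (metis open_ball centre_in_ball inverse_positive_iff_positive of_nat_0_less_iff zero_less_Suc)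
        then show "\<exists>t\<ge>k. dist (z t) p < inverse (real (Suc k))"
          by (auto simp: eventually_sequentially dist_commute)
      qed
      then obtain s where s: "\<And>k. k \<le> s k" "\<And>k. dist (z (s k)) p < inverse (real (Suc k))"
        unfolding choice_iff by blast
      \<comment> \<open>The indices \<open>s k\<close> need not increase; \<open>k \<le> s k\<close>
        suffices for passing to the limit.\<close>
      have s_lim: "filterlim s at_top sequentially"
        by (rule filterlim_at_top_mono[OF filterlim_ident]) (simp add: s(1))
      have "(\<lambda>k. dist (z (s k)) p) \<longlonglongrightarrow> 0"
        by (rule tendsto_sandwich[OF _ _ tendsto_const LIMSEQ_inverse_real_of_nat])
          (auto intro!: always_eventually less_imp_le simp del: of_nat_Suc simp: s(2))
      then have lim: "(\<lambda>k. lift_point \<psi> D (x (s k)) (\<xi> (s k))) \<longlonglongrightarrow> p"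
        unfolding z_def by (rule tendsto_dist_iff[THEN iffD2])
      obtain y \<zeta> where p: "p = lift_point \<psi> D y \<zeta>" and \<zeta>: "\<And>i. \<zeta> i \<in> proj_set (D i) y"
        and y: "(\<lambda>k. x (s k)) \<longlonglongrightarrow> y"
        by (rule lift_point_limit[OF \<psi> assms(2) _ lim]) (rule \<xi>, rule that)
      have "(\<lambda>k. P (s k)) \<longlonglongrightarrow> Psi \<psi> D y"
        unfolding P_def by (rule tendsto_Psi[OF \<psi> y])
      \<comment> \<open>\<open>Psi\<close> has the value \<open>L\<close> at every accumulation
        point, so the KL inequalities of all members of the cover refer to the same gap
        \<open>P t - L\<close>.\<close>
      then have Ly: "Psi \<psi> D y = L"
        using LIMSEQ_unique filterlim_compose[OF L(1) s_lim] by blast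
      obtain N \<nu> \<phi> where N: "open N" "p \<in> N" "0 < \<nu>" "\<phi> \<in> Xi \<nu>"
        and KL: "\<forall>x \<xi>. (\<forall>i. \<xi> i \<in> proj_set (D i) x) \<and> lift_point \<psi> D x \<xi> \<in> N \<and>
          0 < Psi \<psi> D x - L \<and> ereal (Psi \<psi> D x - L) < \<nu> \<longrightarrow>
          1 \<le> deriv \<phi> (Psi \<psi> D x - L) * norm (Psi_grad \<psi> D x \<xi>)"
        by (rule KL_gradient_bound[OF \<psi> assms(5) \<zeta>, folded p, unfolded Ly]) (rule that)
      \<comment> \<open>A real bound strictly below \<nu> lets ordinary convergence of
        \<open>P t - L\<close> to 0 place the gap eventually inside the domain of \<phi>.\<close>
      obtain b where b: "0 < b" "ereal b < \<nu>"
        using ereal_dense2[OF N(3)] by (auto simp: zero_ereal_def)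
      have "(\<lambda>t. P t - L) \<longlonglongrightarrow> L - L" by (intro tendsto_diff L(1) tendsto_const)
      then have "\<forall>\<^sub>F t in sequentially. P t - L < b"
        using b(1) by (intro order_tendstoD) auto
      then have "\<forall>\<^sub>F t in sequentially. 0 \<le> \<phi> (P t - L) \<and> \<phi> (P (Suc t) - L) \<le> \<phi> (P t - L) \<and>
         (z t \<in> N \<longrightarrow> \<sigma> * c / 2 * \<Delta> t \<le> \<phi> (P t - L) - \<phi> (P (Suc t) - L))"
      proof eventually_elim
        case (elim t)
        then have \<nu>: "ereal (P t - L) < \<nu>"
          using b(2) by (meson ereal_less(2) less_ereal.simps(1) less_trans)
        have nonneg: "0 \<le> \<phi> (P t - L)"
          using N(4) \<nu> L(2) by (simp add: Xi_def)
        show ?case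
        \<comment> \<open>The KL inequality requires a strictly positive gap. When the gap vanishes,
          \<open>P\<close> has become stationary and sufficient decrease forces
          \<open>\<Delta> t = 0\<close>.\<close>
        proof (cases "P t = L")
          case True
          then have "P (Suc t) = P t" using P_dec[of t] L(2)[of "Suc t"] by simp
          moreover from this have "\<Delta> t = 0"
            using P_Suc[of t] \<sigma> by (simp add: mult_le_0_iff)
          ultimately show ?thesis using nonneg by simp
        next
          case False
          then have r: "0 < P t - L" using L(2)[of t] by simp
          note inc = Xi_increment[OF N(4), of "P (Suc t) - L" "P t - L"]
          have pos: "0 < deriv \<phi> (P t - L)"
            and tangent: "deriv \<phi> (P t - L) * (P t - P (Suc t)) \<le> \<phi> (P t - L) - \<phi> (P (Suc t) - L)"
            using inc L(2)[of "Suc t"] P_dec[of t] r \<nu> by auto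
          have "0 \<le> deriv \<phi> (P t - L) * (P t - P (Suc t))"
            using pos P_dec[of t] by simp
          moreover have "\<sigma> * c / 2 * \<Delta> t \<le> \<phi> (P t - L) - \<phi> (P (Suc t) - L)" if "z t \<in> N"
          proof -
            have "1 \<le> deriv \<phi> (P t - L) * norm (g t)"
              using KL[rule_format, of "\<xi> t" "x t"] \<xi> that r \<nu> by (simp add: P_def z_def g_def)
            \<comment> \<open>The factor 1 is replaced using KL, then \<open>c * norm (g t)\<close>
              by \<open>\<Delta> t\<close>, and the resulting square by the decrease of
              \<open>P\<close>; concavity of \<phi> finishes the chain.\<close>
            then have "(\<sigma> * c / 2 * \<Delta> t) * 1
                \<le> (\<sigma> * c / 2 * \<Delta> t) * (deriv \<phi> (P t - L) * norm (g t))"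
              using \<sigma> c by (intro mult_left_mono) (auto simp: \<Delta>_def)
            also have "\<dots> = (deriv \<phi> (P t - L) * (\<sigma> / 2) * \<Delta> t) * (c * norm (g t))"
              by (simp add: algebra_simps)
            also have "\<dots> \<le> (deriv \<phi> (P t - L) * (\<sigma> / 2) * \<Delta> t) * \<Delta> t"
              using step[of t] pos \<sigma> by (intro mult_left_mono) (auto simp: \<Delta>_def g_def)
            also have "\<dots> = deriv \<phi> (P t - L) * (\<sigma> / 2 * (\<Delta> t)\<^sup>2)"
              by (simp add: power2_eq_square)
            also have "\<dots> \<le> deriv \<phi> (P t - L) * (P t - P (Suc t))"
              using pos P_Suc[of t] by (intro mult_left_mono) auto
            finally show ?thesis using tangent by simp
          qed
          ultimately show ?thesis using nonneg tangent by auto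
        qed
      qed
      then show ?thesis
        using N(1,2) by (intro exI[of _ N] exI[of _ "\<lambda>t. \<phi> (P t - L)"]) simp
    qed
  qed
  then have summable: "summable \<Delta>"
    using \<sigma> c by (subst (asm) summable_cmult_iff) simp
  \<comment> \<open>The increments are absolutely summable, and their partial sums telescope to
    \<open>x t - x 0\<close>.\<close>
  then have "summable (\<lambda>t. x (Suc t) - x t)"
    unfolding \<Delta>_def by (rule summable_norm_cancel)
  then have "convergent (\<lambda>t. x t - x 0)"
    unfolding summable_iff_convergent sum_lessThan_telescope .
  then have "convergent x"
    using convergent_add[OF _ convergent_const[of "x 0"]] by fastforce
  then obtain xbar where xbar: "x \<longlonglongrightarrow> xbar" by (auto simp: convergent_def)
  \<comment> \<open>The selected projections need not converge with \<open>x\<close>. A convergent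
    subsequence of \<open>z\<close> supplies projections \<zeta> of the limit that are compatible
    with the limit of the gradients.\<close>
  obtain p r where r: "strict_mono (r :: nat \<Rightarrow> nat)" "(z \<circ> r) \<longlonglongrightarrow> p"
    using bounded_imp_convergent_subsequence[OF bdd] by blast
  then have lim: "(\<lambda>k. lift_point \<psi> D (x (r k)) (\<xi> (r k))) \<longlonglongrightarrow> p"
    by (simp add: z_def comp_def)
  obtain y \<zeta> where \<zeta>: "\<And>i. \<zeta> i \<in> proj_set (D i) y" and y: "(\<lambda>k. x (r k)) \<longlonglongrightarrow> y"
    and grad: "(\<lambda>k. Psi_grad \<psi> D (x (r k)) (\<xi> (r k))) \<longlonglongrightarrow> Psi_grad \<psi> D y \<zeta>"
    by (rule lift_point_limit[OF \<psi> assms(2) _ lim]) (rule \<xi>, rule that)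
  have "y = xbar"
    using LIMSEQ_unique[OF y] LIMSEQ_subseq_LIMSEQ[OF xbar r(1)] by (simp add: comp_def)
  \<comment> \<open>Summable step lengths tend to 0, and they dominate
    \<open>c * norm (g t)\<close>.\<close>
  have "g \<longlonglongrightarrow> 0"
  proof (rule Lim_null_comparison)
    show "\<forall>\<^sub>F t in sequentially. norm (g t) \<le> \<Delta> t / c"
      using step c by (simp add: \<Delta>_def g_def field_simps)
    show "(\<lambda>t. \<Delta> t / c) \<longlonglongrightarrow> 0"
      using tendsto_divide[OF summable_LIMSEQ_zero[OF summable] tendsto_const[of c]] c by simp
  qed
  then have "Psi_grad \<psi> D y \<zeta> = 0"
    using LIMSEQ_unique[OF grad] LIMSEQ_subseq_LIMSEQ[OF _ r(1), of g 0]
    by (simp add: g_def comp_def)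
  with \<zeta> have "stationary_point \<psi> D y" by (rule stationary_point_if_Psi_grad_eq_0)
  with xbar \<open>y = xbar\<close> show ?thesis by blast
qed

end
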